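(* Let $d\ge1$, let $\boldsymbol{s}=(s_1,\ldots,s_d)\in\mathbb{Z}_{>0}^d$, and let $\boldsymbol{t}=(t_1,\ldots,t_d)$ be the variables of $R=\mathbb{C}[t_1,\ldots,t_d]$. Put $l(0)=0$, $l(i)=s_1+\cdots+s_i$ for $1\le i\le d$, and $w=l(d)$. Then for every integer $n\ge1$ the following identity holds in the commutative polynomial ring $R[x,y]$: $$ \begin{aligned} M_n(\boldsymbol{s},\boldsymbol{t};x,y) =\sum_{n\ge n_1\ge\cdots\ge n_w\ge1} &\frac{(x+y)^{n-n_1}\;y^{\,n_1+n_{l(1)+1}+\cdots+n_{l(d-1)+1}-n_{l(1)}-\cdots-n_{l(d)}}}{n_1\cdots n_w}\\ &\times\left(\prod_{r=1}^{d-1}(t_rx+y)^{\,n_{l(r)}-n_{l(r)+1}}\right)\left((t_dx+y)^{n_{l(d)}}-y^{n_{l(d)}}\right). \end{aligned} $$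
   Context: For $k\in\mathbb{Z}_{>0}$, $$l_k^{\star}(\boldsymbol{s},\boldsymbol{t})=\sum_{k\ge n_1\ge\cdots\ge n_d\ge1}\frac{t_1^{n_1-n_2}\cdots t_{d-1}^{n_{d-1}-n_d}\,t_d^{n_d}}{n_1^{s_1}\cdots n_d^{s_d}}\in R,$$ and $$M_n(\boldsymbol{s},\boldsymbol{t};x,y)=\sum_{k=1}^n\binom{n}{k}x^ky^{n-k}\,l_k^{\star}(\boldsymbol{s},\boldsymbol{t})\in R[x,y].$$ (This is the limit as $q\to1$ of the analogous sums with $q$-integers and $q$-binomial coefficients.) The exponent of $y$ in the claim is $\sum_{r=1}^{d}\bigl(n_{l(r-1)+1}-n_{l(r)}\bigr)\ge0$. Empty products equal $1$. *)

theory Defs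
  imports Complex_Main "HOL-Library.FuncSet" "HOL-Library.Poly_Mapping"
begin

text \<open>
  The commutative polynomial ring over \<open>'a\<close> with indeterminates indexed by \<open>'v\<close>: a polynomial
  is a finitely supported map from monomials (finitely supported exponent vectors) to coefficients,
  with the convolution product.
\<close>
type_synonym ('v, 'a) mpoly = "('v \<Rightarrow>\<^sub>0 nat) \<Rightarrow>\<^sub>0 'a"

definition pvar :: "'v \<Rightarrow> ('v, 'a::zero_neq_one) mpoly"
  where "pvar v = Poly_Mapping.single (Poly_Mapping.single v 1) 1"

definition pconst :: "'a::zero \<Rightarrow> ('v, 'a) mpoly"
  where "pconst c = Poly_Mapping.single 0 c"

text \<open>
  The indeterminates of \<open>R\<close> are indexed by all natural numbers, since the number \<open>d\<close> of them
  cannot be a parameter of the type.  The polynomial ring \<open>\<complex>[t\<^sub>1, \<dots>, t\<^sub>d]\<close> is the subring of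
  polynomials in \<open>tvar 1, \<dots>, tvar d\<close>.
\<close>
type_synonym R = "(nat, complex) mpoly"

definition tvar :: "nat \<Rightarrow> R"
  where "tvar i = pvar i"

datatype xy = X | Y

type_synonym Rxy = "(xy, R) mpoly"

text \<open>
  The sequences \<open>k \<ge> n\<^sub>1 \<ge> \<dots> \<ge> n\<^sub>r \<ge> 1\<close>, indexed from 1; extensionality outside \<open>{1..r}\<close>
  makes each sequence occur exactly once.
\<close>
definition desc_seqs :: "nat \<Rightarrow> nat \<Rightarrow> (nat \<Rightarrow> nat) set"
  where "desc_seqs r k = {m \<in> {1..r} \<rightarrow>\<^sub>E {1..k}. \<forall>i\<in>{1..<r}. m i \<ge> m (i + 1)}"

text \<open>
  Tuples \<open>(s\<^sub>1, \<dots>, s\<^sub>d)\<close> and \<open>(t\<^sub>1, \<dots>, t\<^sub>d)\<close> are functions on \<open>nat\<close> of which only the values at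
  \<open>1, \<dots>, d\<close> are used.  Subtraction of exponents never truncates, as the sequences are weakly decreasing.
\<close>
definition lstar :: "nat \<Rightarrow> (nat \<Rightarrow> nat) \<Rightarrow> (nat \<Rightarrow> R) \<Rightarrow> nat \<Rightarrow> R"
  where "lstar d s t k =
    (\<Sum>m\<in>desc_seqs d k.
      pconst (1 / (\<Prod>i=1..d. of_nat (m i) ^ s i)) *
      ((\<Prod>i=1..<d. t i ^ (m i - m (i + 1))) * t d ^ m d))"

definition M :: "nat \<Rightarrow> (nat \<Rightarrow> nat) \<Rightarrow> (nat \<Rightarrow> R) \<Rightarrow> nat \<Rightarrow> Rxy \<Rightarrow> Rxy \<Rightarrow> Rxy"
  where "M d s t n x y =
    (\<Sum>k=1..n. of_nat (n choose k) * x ^ k * y ^ (n - k) * pconst (lstar d s t k))"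

definition l :: "(nat \<Rightarrow> nat) \<Rightarrow> nat \<Rightarrow> nat"
  where "l s i = (\<Sum>j=1..i. s j)"

end

theory Submission imports Defs begin

text \<open>
  Let \<open>S\<^sub>u\<close> be the operator \<open>(S\<^sub>u a) k = (\<Sum>j=1..k. u ^ (k - j) * a j)\<close>, \<open>D\<close> the operator
  \<open>(D a) k = a k / k\<close>, and \<open>B\<close> the weighted binomial transform.  Then \<open>l\<^sub>k\<^sup>\<star>\<close> is obtained from
  \<open>t\<^sub>d\<^sup>k\<close> by applying \<open>S\<^sub>1 D\<^bsup>s\<^sub>1\<^esup> S\<^bsub>t\<^sub>1\<^esub> D\<^bsup>s\<^sub>2\<^esup> \<dots>\<close>.  Pascal's rule and absorption give
  \<open>B S\<^sub>u D = S\<^bsub>u x + y\<^esub> D B\<close> and \<open>B D = S\<^sub>y D B\<close>, which move \<open>B\<close> through to \<open>t\<^sub>d\<^sup>k\<close>, where the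
  binomial theorem applies.
\<close>

definition star_op :: "'a::comm_ring_1 \<Rightarrow> (nat \<Rightarrow> 'a) \<Rightarrow> nat \<Rightarrow> 'a"
  where "star_op u a k = (\<Sum>j=1..k. u ^ (k - j) * a j)"

text \<open>The operator with index \<open>0\<close> is outermost. The recursion adds the innermost
  one, so that the summation sequences grow at their last entry.\<close>

fun nest :: "(nat \<Rightarrow> 'a::comm_ring_1) \<Rightarrow> (nat \<Rightarrow> nat \<Rightarrow> 'a) \<Rightarrow> nat \<Rightarrow> (nat \<Rightarrow> 'a) \<Rightarrow> nat \<Rightarrow> 'a"
  where
    "nest u g 0 b = b"
  | "nest u g (Suc r) b = nest u g r (star_op (u r) (\<lambda>j. g r j * b j))"

definition binom_transform :: "'a::comm_ring_1 \<Rightarrow> 'a \<Rightarrow> (nat \<Rightarrow> 'a) \<Rightarrow> nat \<Rightarrow> 'a"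
  where "binom_transform x y b n = (\<Sum>k=1..n. of_nat (n choose k) * x ^ k * y ^ (n - k) * b k)"


subsection \<open>Iterated sums\<close>

lemma star_op_0 [simp]: "star_op u a 0 = 0"
  by (simp add: star_op_def)

lemma star_op_Suc: "star_op u a (Suc k) = u * star_op u a k + a (Suc k)"
  by (simp add: star_op_def sum_distrib_left Suc_diff_le mult.assoc)

text \<open>A first-order recurrence with zero start has one solution, so both commutation rules for
  the transform reduce to checking this recurrence.\<close>

lemma star_op_eqI:
  assumes "f 0 = 0" and "\<And>k. f (Suc k) = u * f k + a (Suc k)"
  shows "f = star_op u a"
proof
  show "f k = star_op u a k" for k
    by (induction k) (simp_all add: assms star_op_Suc)
qed

lemma nest_cong:
  assumes "\<And>i. i < r \<Longrightarrow> u i = v i" and "\<And>i. i < r \<Longrightarrow> g i = h i"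
  shows "nest u g r b = nest v h r b"
  using assms by (induction r arbitrary: b) simp_all

lemma nest_add:
  "nest u g (a + p) b = nest u g a (nest (\<lambda>i. u (a + i)) (\<lambda>i. g (a + i)) p b)"
  by (induction p arbitrary: b) simp_all

lemma finite_desc_seqs: "finite (desc_seqs r n)"
  by (rule finite_subset[of _ "{1..r} \<rightarrow>\<^sub>E {1..n}"])
    (auto simp: desc_seqs_def intro: finite_PiE)

text \<open>Updating \<open>m\<close> at \<open>0\<close> supplies the upper bound \<open>n\<close> as a zeroth term of the sequence.\<close>

lemma desc_seqs_extend:
  assumes "m \<in> desc_seqs r n" and "1 \<le> j" and "j \<le> (m(0 := n)) r"
  shows "m(Suc r := j) \<in> desc_seqs (Suc r) n"
proof -
  have m: "m \<in> {1..r} \<rightarrow>\<^sub>E {1..n}" and dec: "\<forall>i\<in>{1..<r}. m (i + 1) \<le> m i"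
    using assms(1) by (auto simp: desc_seqs_def)
  \<comment> \<open>For \<open>r = 0\<close> this term is \<open>n\<close> itself; otherwise it is
    an entry of \<open>m\<close>, hence in \<open>{1..n}\<close>.\<close>
  have "(m(0 := n)) r \<le> n"
    using m by (cases "r = 0") (auto dest!: PiE_mem[of _ _ _ r])
  with assms have "j \<in> {1..n}" by simp
  with m have "m(Suc r := j) \<in> insert (Suc r) {1..r} \<rightarrow>\<^sub>E {1..n}"
    by (intro PiE_fun_upd) auto
  moreover have "insert (Suc r) {1..r} = {1..Suc r}" by auto
  moreover have "(m(Suc r := j)) (i + 1) \<le> (m(Suc r := j)) i" if "i \<in> {1..<Suc r}" for i
    using that dec assms by (cases "i = r") auto
  ultimately show ?thesis by (simp add: desc_seqs_def)
qed

text \<open>Deleting the last entry undoes \<open>desc_seqs_extend\<close>; together they give the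
  bijection behind \<open>sum_desc_seqs_Suc\<close>.\<close>

lemma desc_seqs_restrict:
  assumes "m \<in> desc_seqs (Suc r) n"
  shows "restrict m {1..r} \<in> desc_seqs r n"
    and "1 \<le> m (Suc r)" and "m (Suc r) \<le> ((restrict m {1..r})(0 := n)) r"
    and "(restrict m {1..r})(Suc r := m (Suc r)) = m"
proof -
  have m: "m \<in> {1..Suc r} \<rightarrow>\<^sub>E {1..n}" and dec: "\<forall>i\<in>{1..<Suc r}. m (i + 1) \<le> m i"
    using assms by (auto simp: desc_seqs_def)
  show "restrict m {1..r} \<in> desc_seqs r n"
    using m dec by (auto simp: desc_seqs_def PiE_iff)
  have "m (Suc r) \<in> {1..n}"
    using m by (auto dest: PiE_mem[of _ _ _ "Suc r"])
  then show "1 \<le> m (Suc r)" "m (Suc r) \<le> ((restrict m {1..r})(0 := n)) r"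
    using dec by auto
  show "(restrict m {1..r})(Suc r := m (Suc r)) = m"
    using m by (auto simp: fun_eq_iff PiE_iff extensional_def restrict_def)
qed

lemma sum_desc_seqs_Suc:
  "(\<Sum>m\<in>desc_seqs (Suc r) n. F m) =
    (\<Sum>m\<in>desc_seqs r n. \<Sum>j=1..(m(0 := n)) r. F (m(Suc r := j)))"
proof -
  have "(\<Sum>m\<in>desc_seqs r n. \<Sum>j=1..(m(0 := n)) r. F (m(Suc r := j))) =
      (\<Sum>(m, j)\<in>(SIGMA m:desc_seqs r n. {1..(m(0 := n)) r}). F (m(Suc r := j)))"
    by (rule sum.Sigma) (auto simp: finite_desc_seqs)
  also have "\<dots> = (\<Sum>m\<in>desc_seqs (Suc r) n. F m)"
  proof (rule sum.reindex_bij_witness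
      [where j = "\<lambda>(m, j). m(Suc r := j)" and i = "\<lambda>m. (restrict m {1..r}, m (Suc r))"], goal_cases)
    case (1 a)
    then obtain m j where a: "a = (m, j)" and m: "m \<in> desc_seqs r n" by auto
    then have "restrict (m(Suc r := j)) {1..r} = m"
      by (auto simp: desc_seqs_def fun_eq_iff PiE_iff extensional_def restrict_def)
    with a show ?case by simp
  next
    case (2 a)
    then show ?case using desc_seqs_extend by auto
  next
    case (3 m)
    then show ?case using desc_seqs_restrict(4) by simp
  next
    case (4 m)
    then show ?case unfolding mem_Sigma_iff atLeastAtMost_iff using desc_seqs_restrict by blast
  next
    case (5 a)
    then show ?case by auto
  qed
  finally show ?thesis by simp
qed

text \<open>Each \<open>star_op\<close> contributes one summation index, bounded by the index of the
  operator outside it and by \<open>n\<close> for the outermost.\<close>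

lemma nest_eq_sum:
  "nest u g r b n =
    (\<Sum>m\<in>desc_seqs r n.
      (\<Prod>i<r. u i ^ ((m(0 := n)) i - m (Suc i)) * g i (m (Suc i))) * b ((m(0 := n)) r))"
proof (induction r arbitrary: b)
  case 0
  have "desc_seqs 0 n = {\<lambda>_. undefined}" by (auto simp: desc_seqs_def)
  then show ?case by simp
next
  case (Suc r)
  let ?P = "\<lambda>m. \<Prod>i<r. u i ^ ((m(0 := n)) i - m (Suc i)) * g i (m (Suc i))"
  \<comment> \<open>The first \<open>r\<close> factors only involve entries up to index
    \<open>r\<close>.\<close>
  have P: "?P (m(Suc r := j)) = ?P m" for m j
    by (rule prod.cong) auto
  show ?case
    unfolding nest.simps Suc.IH sum_desc_seqs_Suc star_op_def sum_distrib_left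
  proof (intro sum.cong refl)
    fix m j
    have "(\<Prod>i<Suc r. u i ^ (((m(Suc r := j))(0 := n)) i - (m(Suc r := j)) (Suc i)) *
        g i ((m(Suc r := j)) (Suc i))) =
        ?P (m(Suc r := j)) * (u r ^ ((m(0 := n)) r - j) * g r j)"
      by simp
    then show "?P m * (u r ^ ((m(0 := n)) r - j) * (g r j * b j)) =
        (\<Prod>i<Suc r. u i ^ (((m(Suc r := j))(0 := n)) i - (m(Suc r := j)) (Suc i)) *
          g i ((m(Suc r := j)) (Suc i))) * b (((m(Suc r := j))(0 := n)) (Suc r))"
      unfolding P by (simp add: mult.assoc)
  qed
qed


subsection \<open>The binomial transform\<close>

lemma binom_transform_0 [simp]: "binom_transform x y b 0 = 0"
  by (simp add: binom_transform_def)

lemma binom_transform_shift: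
  "binom_transform x y b (Suc n) =
    (\<Sum>k\<le>n. of_nat (Suc n choose Suc k) * x ^ Suc k * y ^ (n - k) * b (Suc k))"
  unfolding binom_transform_def
  by (rule sum.reindex_bij_witness[where i = Suc and j = "\<lambda>k. k - 1"]) auto

text \<open>Pascal's rule splits \<open>Suc n choose Suc k\<close>: the part
  \<open>n choose Suc k\<close> rebuilds \<open>y\<close> times the transform at \<open>n\<close>,
  the part \<open>n choose k\<close> is the remaining sum.\<close>

lemma binom_transform_Suc:
  "binom_transform x y b (Suc n) =
    y * binom_transform x y b n + (\<Sum>k\<le>n. of_nat (n choose k) * x ^ Suc k * y ^ (n - k) * b (Suc k))"
proof -
  have "y * binom_transform x y b n =
      (\<Sum>k<n. of_nat (n choose Suc k) * x ^ Suc k * y ^ (n - k) * b (Suc k))"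
    unfolding binom_transform_def sum_distrib_left
  proof (rule sum.reindex_bij_witness[where i = Suc and j = "\<lambda>k. k - 1"], goal_cases)
    case (5 k)
    then have "n - (k - 1) = Suc (n - k)" and "Suc (k - 1) = k" by auto
    then show ?case by (simp only: power_Suc) (simp add: algebra_simps)
  qed auto
  \<comment> \<open>The added term \<open>k = n\<close> vanishes because
    \<open>n choose Suc n\<close> is zero.\<close>
  also have "\<dots> = (\<Sum>k\<le>n. of_nat (n choose Suc k) * x ^ Suc k * y ^ (n - k) * b (Suc k))"
    by (simp add: lessThan_Suc_atMost[symmetric] binomial_eq_0)
  finally show ?thesis
    unfolding binom_transform_shift by (simp add: algebra_simps sum.distrib)
qed

text \<open>The binomial theorem; \<open>y ^ n\<close> is subtracted because the transform omits
  \<open>k = 0\<close>.\<close>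

lemma binom_transform_power:
  "binom_transform x y (\<lambda>k. t ^ k) n = (t * x + y) ^ n - y ^ n"
proof -
  have "(t * x + y) ^ n = (\<Sum>k\<le>n. of_nat (n choose k) * x ^ k * y ^ (n - k) * t ^ k)"
    unfolding binomial_ring by (intro sum.cong) (simp_all add: power_mult_distrib mult_ac)
  also have "\<dots> = y ^ n + binom_transform x y (\<lambda>k. t ^ k) n"
    by (simp add: binom_transform_def atMost_atLeast0 sum.atLeast_Suc_atMost)
  finally show ?thesis by simp
qed

text \<open>\<open>\<iota>\<close> inverts the positive integers; its value at \<open>0\<close> is
  left free.\<close>

context
  fixes \<iota> :: "nat \<Rightarrow> 'a::comm_ring_1"
  assumes inverse: "\<And>k. of_nat (Suc k) * \<iota> (Suc k) = 1"
begin

text \<open>Dividing \<open>Suc k * (Suc n choose Suc k) = Suc n * (n choose k)\<close> by both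
  outer factors trades the inner \<open>\<iota> (Suc k)\<close> for \<open>\<iota> (Suc n)\<close>
  outside the sum.\<close>

lemma absorption:
  "(\<Sum>k\<le>n. of_nat (n choose k) * x ^ Suc k * y ^ (n - k) * (\<iota> (Suc k) * b (Suc k))) =
    \<iota> (Suc n) * binom_transform x y b (Suc n)"
proof -
  have "of_nat (n choose k) * \<iota> (Suc k) = \<iota> (Suc n) * of_nat (Suc n choose Suc k)" for k
  proof -
    have "of_nat (n choose k) * \<iota> (Suc k) =
        of_nat (Suc n) * \<iota> (Suc n) * (of_nat (n choose k) * \<iota> (Suc k))"
      by (simp only: inverse mult_1_left)
    also have "\<dots> = \<iota> (Suc n) * of_nat (Suc n * (n choose k)) * \<iota> (Suc k)"
      by (simp only: of_nat_mult mult_ac)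
    also have "\<dots> = \<iota> (Suc n) * of_nat (Suc k * (Suc n choose Suc k)) * \<iota> (Suc k)"
      by (simp only: Suc_times_binomial)
    also have "\<dots> = \<iota> (Suc n) * of_nat (Suc n choose Suc k) * (of_nat (Suc k) * \<iota> (Suc k))"
      by (simp only: of_nat_mult mult_ac)
    finally show ?thesis by (simp only: inverse mult_1_right)
  qed
  then have "of_nat (n choose k) * \<iota> (Suc k) * (x ^ Suc k * y ^ (n - k) * b (Suc k)) =
      \<iota> (Suc n) * of_nat (Suc n choose Suc k) * (x ^ Suc k * y ^ (n - k) * b (Suc k))" for k
    by (simp only:)
  then show ?thesis
    unfolding binom_transform_shift sum_distrib_left
    by (intro sum.cong refl) (simp only: mult_ac)
qed

text \<open>By \<open>absorption\<close>, the remainder in Pascal's rule is the inhomogeneous term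
  of a recurrence with ratio \<open>y\<close>.\<close>

lemma binom_transform_divide:
  "binom_transform x y (\<lambda>j. \<iota> j * b j) = star_op y (\<lambda>j. \<iota> j * binom_transform x y b j)"
  by (rule star_op_eqI) (simp_all only: binom_transform_0 binom_transform_Suc[of x y "\<lambda>j. \<iota> j * b j"] absorption)

lemma binom_transform_star_op:
  "binom_transform x y (star_op u (\<lambda>j. \<iota> j * b j)) =
    star_op (u * x + y) (\<lambda>j. \<iota> j * binom_transform x y b j)"
proof (rule star_op_eqI)
  let ?c = "star_op u (\<lambda>j. \<iota> j * b j)"
  fix n
  \<comment> \<open>The recurrence of \<open>?c\<close> splits the Pascal remainder; its first part
    adds \<open>u * x\<close> to the ratio \<open>y\<close>.\<close>
  have "(\<Sum>k\<le>n. of_nat (n choose k) * x ^ Suc k * y ^ (n - k) * ?c (Suc k)) =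
      u * x * (\<Sum>k\<le>n. of_nat (n choose k) * x ^ k * y ^ (n - k) * ?c k) +
      (\<Sum>k\<le>n. of_nat (n choose k) * x ^ Suc k * y ^ (n - k) * (\<iota> (Suc k) * b (Suc k)))"
    by (simp add: star_op_Suc sum_distrib_left sum.distrib[symmetric] algebra_simps)
  \<comment> \<open>The term \<open>k = 0\<close> may be dropped since
    \<open>?c 0 = 0\<close>.\<close>
  also have "(\<Sum>k\<le>n. of_nat (n choose k) * x ^ k * y ^ (n - k) * ?c k) = binom_transform x y ?c n"
    by (simp add: binom_transform_def atMost_atLeast0 sum.atLeast_Suc_atMost)
  finally show "binom_transform x y ?c (Suc n) =
      (u * x + y) * binom_transform x y ?c n + \<iota> (Suc n) * binom_transform x y b (Suc n)"
    unfolding binom_transform_Suc[of x y ?c] absorption by (simp add: algebra_simps)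
qed simp

lemma binom_transform_divide_power:
  "binom_transform x y (\<lambda>j. \<iota> j ^ p * b j) = nest (\<lambda>_. y) (\<lambda>_. \<iota>) p (binom_transform x y b)"
proof (induction p arbitrary: b)
  case (Suc p)
  have "(\<lambda>j. \<iota> j ^ Suc p * b j) = (\<lambda>j. \<iota> j ^ p * (\<iota> j * b j))"
    by (simp add: fun_eq_iff mult_ac)
  then show ?case
    by (simp only: Suc.IH binom_transform_divide nest.simps)
qed simp

text \<open>The first division is paired with \<open>star_op u\<close> and yields the ratio
  \<open>u * x + y\<close>; each of the other \<open>p - 1\<close> divisions yields
  \<open>y\<close>. Hence \<open>p > 0\<close>.\<close>

lemma binom_transform_block:
  assumes "p > 0" and "v 0 = u * x + y" and "\<And>i. 0 < i \<Longrightarrow> i < p \<Longrightarrow> v i = y"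
  shows "binom_transform x y (star_op u (\<lambda>j. \<iota> j ^ p * b j)) =
    nest v (\<lambda>_. \<iota>) p (binom_transform x y b)"
proof -
  obtain q where p: "p = 1 + q" using assms(1) by (cases p) auto
  have "(\<lambda>j. \<iota> j ^ p * b j) = (\<lambda>j. \<iota> j * (\<iota> j ^ q * b j))"
    by (simp add: p fun_eq_iff mult_ac)
  then have "binom_transform x y (star_op u (\<lambda>j. \<iota> j ^ p * b j)) =
      star_op (v 0) (\<lambda>j. \<iota> j * nest (\<lambda>_. y) (\<lambda>_. \<iota>) q (binom_transform x y b) j)"
    by (simp only: binom_transform_star_op binom_transform_divide_power assms(2))
  also have "nest (\<lambda>_. y) (\<lambda>_. \<iota>) q = nest (\<lambda>i. v (1 + i)) (\<lambda>_. \<iota>) q"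
    by (rule ext, rule nest_cong) (use assms(3) p in auto)
  finally show ?thesis
    unfolding p nest_add[of v _ 1 q] by simp
qed

text \<open>Induction on the number of blocks: the transform passes the outer \<open>d\<close>
  blocks by hypothesis, then the innermost, whose positions start at \<open>l s d\<close>, by
  \<open>binom_transform_block\<close>.\<close>

lemma binom_transform_nest:
  assumes "\<And>i. i < d \<Longrightarrow> s (Suc i) > 0"
    and "\<And>r. r < d \<Longrightarrow> v (l s r) = u r * x + y"
    and "\<And>r i. r < d \<Longrightarrow> l s r < i \<Longrightarrow> i < l s (Suc r) \<Longrightarrow> v i = y"
  shows "binom_transform x y (nest u (\<lambda>i j. \<iota> j ^ s (Suc i)) d b) =
    nest v (\<lambda>_. \<iota>) (l s d) (binom_transform x y b)"
  using assms
proof (induction d arbitrary: b)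
  case 0
  then show ?case by (simp add: l_def)
next
  case (Suc d)
  have l: "l s (Suc d) = l s d + s (Suc d)" by (simp add: l_def)
  have "binom_transform x y (nest u (\<lambda>i j. \<iota> j ^ s (Suc i)) (Suc d) b) =
      nest v (\<lambda>_. \<iota>) (l s d)
        (binom_transform x y (star_op (u d) (\<lambda>j. \<iota> j ^ s (Suc d) * b j)))"
    unfolding nest.simps by (rule Suc.IH) (use Suc.prems less_SucI in blast)+
  also have "binom_transform x y (star_op (u d) (\<lambda>j. \<iota> j ^ s (Suc d) * b j)) =
      nest (\<lambda>i. v (l s d + i)) (\<lambda>_. \<iota>) (s (Suc d)) (binom_transform x y b)"
    by (rule binom_transform_block) (use Suc.prems(1,2)[of d] Suc.prems(3)[of d] l in auto)
  finally show ?case by (simp only: l nest_add)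
qed

end


subsection \<open>Exponents\<close>

lemma l_mono: "i \<le> j \<Longrightarrow> l s i \<le> l s j"
  unfolding l_def by (rule sum_mono2) auto

lemma desc_seqs_antimono:
  assumes "m \<in> desc_seqs w n" and "1 \<le> i" and "i \<le> j" and "j \<le> w"
  shows "m j \<le> m i"
  using assms(3,4)
proof (induction j rule: dec_induct)
  case (step k)
  moreover have "m (Suc k) \<le> m k"
    using assms(1,2) step by (auto simp: desc_seqs_def)
  ultimately show ?case by simp
qed simp

text \<open>Both claims are proved in one induction, since adding exponents under truncated
  subtraction requires the second.\<close>

lemma prod_power_telescope:
  fixes y :: "'a::comm_monoid_mult" and m :: "nat \<Rightarrow> nat"
  assumes "a \<le> b" and "\<And>i. a \<le> i \<Longrightarrow> i < b \<Longrightarrow> m (Suc i) \<le> m i"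
  shows "(\<Prod>i=a..<b. y ^ (m i - m (Suc i))) = y ^ (m a - m b)"
    and "m b \<le> m a"
  using assms
proof (induction b rule: dec_induct)
  case (step k)
  { case 1
    with step show ?case by (simp add: power_add[symmetric])
  next
    case 2
    with step show ?case by (meson less_SucI lessI order.trans)
  }
qed simp_all

text \<open>In each block the first factor carries \<open>z r\<close> and the rest, all powers of
  \<open>y\<close>, telescope. The length \<open>w\<close> is kept apart from \<open>l s d\<close>
  so that \<open>m\<close> stays fixed in the induction on \<open>d\<close>.\<close>

lemma prod_blocks:
  fixes v :: "nat \<Rightarrow> 'a::comm_ring_1"
  assumes "m \<in> desc_seqs w n" and "l s d \<le> w"
    and "\<And>i. i < d \<Longrightarrow> s (Suc i) > 0"
    and "\<And>r. r < d \<Longrightarrow> v (l s r) = z r"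
    and "\<And>r i. r < d \<Longrightarrow> l s r < i \<Longrightarrow> i < l s (Suc r) \<Longrightarrow> v i = y"
  shows "(\<Prod>i<l s d. v i ^ ((m(0 := n)) i - m (Suc i))) =
    y ^ (\<Sum>r<d. m (l s r + 1) - m (l s (Suc r))) *
    (\<Prod>r<d. z r ^ ((m(0 := n)) (l s r) - m (l s r + 1)))"
  using assms(2-)
proof (induction d)
  case 0
  then show ?case by (simp add: l_def)
next
  case (Suc d)
  have l: "l s (Suc d) = l s d + s (Suc d)" by (simp add: l_def)
  have pos: "l s d < l s (Suc d)" using Suc.prems(2) l by simp
  \<comment> \<open>All indices here are positive, so the update at \<open>0\<close> is not
    seen.\<close>
  have "(\<Prod>i=Suc (l s d)..<l s (Suc d). v i ^ ((m(0 := n)) i - m (Suc i))) =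
      (\<Prod>i=Suc (l s d)..<l s (Suc d). y ^ (m i - m (Suc i)))"
    using Suc.prems(4)[of d] by (intro prod.cong) auto
  also have "\<dots> = y ^ (m (l s d + 1) - m (l s (Suc d)))"
    unfolding Suc_eq_plus1[symmetric]
    using pos Suc.prems(1) by (intro prod_power_telescope(1) desc_seqs_antimono[OF assms(1)]) auto
  finally have block: "(\<Prod>i=l s d..<l s (Suc d). v i ^ ((m(0 := n)) i - m (Suc i))) =
      z d ^ ((m(0 := n)) (l s d) - m (l s d + 1)) * y ^ (m (l s d + 1) - m (l s (Suc d)))"
    using pos Suc.prems(3) by (simp add: prod.atLeast_Suc_lessThan)
  have "(\<Prod>i<l s (Suc d). v i ^ ((m(0 := n)) i - m (Suc i))) =
      (\<Prod>i<l s d. v i ^ ((m(0 := n)) i - m (Suc i))) *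
      (\<Prod>i=l s d..<l s (Suc d). v i ^ ((m(0 := n)) i - m (Suc i)))"
    unfolding lessThan_atLeast0 by (rule prod.atLeastLessThan_concat[symmetric]) (use pos in auto)
  moreover have "(\<Prod>i<l s d. v i ^ ((m(0 := n)) i - m (Suc i))) =
    y ^ (\<Sum>r<d. m (l s r + 1) - m (l s (Suc r))) *
    (\<Prod>r<d. z r ^ ((m(0 := n)) (l s r) - m (l s r + 1)))"
  proof (rule Suc.IH)
    show "l s d \<le> w" using pos Suc.prems(1) by linarith
  qed (use Suc.prems less_SucI in blast)+
  ultimately show ?case
    unfolding block by (simp only: sum.lessThan_Suc prod.lessThan_Suc power_add mult_ac)
qed

text \<open>Since \<open>l s\<close> is monotone, no position lies in two blocks, so weights can be
  prescribed block by block. The strict inequalities exclude empty blocks, whose starting positions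
  coincide with those of later ones.\<close>

lemma ex_gap_weights:
  fixes z :: "nat \<Rightarrow> 'a" and y :: 'a
  obtains v where "\<And>r. l s r < l s (Suc r) \<Longrightarrow> v (l s r) = z r"
    and "\<And>r i. l s r < i \<Longrightarrow> i < l s (Suc r) \<Longrightarrow> v i = y"
proof -
  \<comment> \<open>The least such \<open>r\<close> is the index of the block containing
    \<open>i\<close>.\<close>
  define v where "v i = (let r = LEAST r. i < l s (Suc r) in if i = l s r then z r else y)" for i
  have "(LEAST r. i < l s (Suc r)) = r" if "l s r \<le> i" "i < l s (Suc r)" for r i
  proof (rule Least_equality)
    fix q assume "i < l s (Suc q)"
    then show "r \<le> q" using that l_mono[of "Suc q" r s] by (cases "r \<le> q") auto
  qed (rule that)
  then have v: "v i = (if i = l s r then z r else y)" if "l s r \<le> i" "i < l s (Suc r)" for r i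
    using that by (simp add: v_def)
  show thesis
  proof (rule that[of v])
    show "v (l s r) = z r" if "l s r < l s (Suc r)" for r
      using v[of r "l s r"] that by simp
    show "v i = y" if "l s r < i" "i < l s (Suc r)" for r i
      using v[of r i] that by simp
  qed
qed

text \<open>Blocks are nonempty and \<open>m\<close> decreases weakly, so no difference truncates
  and the two sums can be subtracted as wholes. The term \<open>m 1\<close> comes from
  \<open>r = 0\<close>.\<close>

lemma exponent_of_y:
  assumes m: "m \<in> desc_seqs (l s d) n" and "d \<ge> 1" and "\<And>i. i < d \<Longrightarrow> s (Suc i) > 0"
  shows "(\<Sum>r<d. m (l s r + 1) - m (l s (Suc r))) =
    m 1 + (\<Sum>r=1..<d. m (l s r + 1)) - (\<Sum>r=1..d. m (l s r))"
proof -
  have "m (l s (Suc r)) \<le> m (l s r + 1)" if "r < d" for r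
  proof (rule desc_seqs_antimono[OF m])
    show "l s r + 1 \<le> l s (Suc r)" using assms(3)[OF that] by (simp add: l_def)
    show "l s (Suc r) \<le> l s d" using that by (intro l_mono) auto
  qed simp
  then have "(\<Sum>r<d. m (l s r + 1) - m (l s (Suc r))) =
      (\<Sum>r<d. m (l s r + 1)) - (\<Sum>r<d. m (l s (Suc r)))"
    by (intro sum_subtractf_nat) auto
  also have "(\<Sum>r<d. m (l s r + 1)) = m 1 + (\<Sum>r=1..<d. m (l s r + 1))"
    using assms(2) by (simp add: lessThan_atLeast0 sum.atLeast_Suc_lessThan l_def)
  also have "(\<Sum>r<d. m (l s (Suc r))) = (\<Sum>r=1..d. m (l s r))"
    by (rule sum.reindex_bij_witness[where i = "\<lambda>k. k - 1" and j = Suc]) auto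
  finally show ?thesis .
qed


subsection \<open>Constants\<close>

lemma pconst_1 [simp]: "pconst 1 = 1"
  by (simp add: pconst_def)

lemma pconst_add: "pconst (a + b) = pconst a + pconst b"
  by (simp add: pconst_def single_add)

lemma pconst_0 [simp]: "pconst 0 = 0"
  by (simp add: pconst_def)

lemma pconst_mult: "pconst (a * b) = pconst a * pconst b"
  by (simp add: pconst_def mult_single)

lemma pconst_of_nat: "pconst (of_nat k) = of_nat k"
  by (induction k) (simp_all add: pconst_add)

lemma pconst_power: "pconst (a ^ k) = pconst a ^ k"
  by (induction k) (simp_all add: pconst_mult)

lemma pconst_sum: "pconst (\<Sum>i\<in>A. f i) = (\<Sum>i\<in>A. pconst (f i))"
  by (induction A rule: infinite_finite_induct) (simp_all add: pconst_add)

lemma pconst_prod: "pconst (\<Prod>i\<in>A. f i) = (\<Prod>i\<in>A. pconst (f i))"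
  by (induction A rule: infinite_finite_induct) (simp_all add: pconst_mult)

text \<open>The bound \<open>k\<close> on the first index carries no weight, so the outermost ratio
  is \<open>1\<close>. The inner \<open>pconst\<close> embeds the complex numbers into
  \<open>R\<close>, the outer one \<open>R\<close> into \<open>Rxy\<close>.\<close>

lemma pconst_lstar:
  fixes t :: "nat \<Rightarrow> R"
  assumes "d \<ge> 1"
  shows "(pconst (lstar d s t k) :: Rxy) =
    nest (\<lambda>r. if r = 0 then 1 else pconst (t r)) (\<lambda>i j. pconst (pconst (1 / of_nat j)) ^ s (Suc i))
      d (\<lambda>j. pconst (t d) ^ j) k"
  unfolding lstar_def nest_eq_sum pconst_sum
proof (intro sum.cong refl)
  fix m
  let ?u = "\<lambda>r. if r = 0 then 1 else (pconst (t r) :: Rxy)"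
  let ?\<iota> = "\<lambda>j. pconst (pconst (1 / of_nat j)) :: Rxy"
  have "(\<Prod>i<d. ?u i ^ ((m(0 := k)) i - m (Suc i))) = (\<Prod>i=1..<d. pconst (t i) ^ (m i - m (i + 1)))"
    using assms by (simp add: lessThan_atLeast0 prod.atLeast_Suc_lessThan)
  moreover have "(\<Prod>i<d. ?\<iota> (m (Suc i)) ^ s (Suc i)) =
      pconst (pconst (1 / (\<Prod>i=1..d. of_nat (m i) ^ s i)))"
  proof -
    have "(\<Prod>i<d. ?\<iota> (m (Suc i)) ^ s (Suc i)) = (\<Prod>i=1..d. ?\<iota> (m i) ^ s i)"
      by (rule prod.reindex_bij_witness[where i = "\<lambda>k. k - 1" and j = Suc]) auto
    moreover have "1 / (\<Prod>i=1..d. of_nat (m i) ^ s i) = (\<Prod>i=1..d. (1 / of_nat (m i) :: complex) ^ s i)"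
      by (simp add: prod_dividef power_divide)
    ultimately show ?thesis by (simp only: pconst_prod pconst_power)
  qed
  ultimately show "pconst (pconst (1 / (\<Prod>i=1..d. of_nat (m i) ^ s i)) *
        ((\<Prod>i=1..<d. t i ^ (m i - m (i + 1))) * t d ^ m d)) =
      (\<Prod>i<d. ?u i ^ ((m(0 := k)) i - m (Suc i)) * ?\<iota> (m (Suc i)) ^ s (Suc i)) *
        pconst (t d) ^ (m(0 := k)) d"
    using assms by (simp only: prod.distrib pconst_mult pconst_prod pconst_power) (simp add: mult_ac)
qed

theorem corollary1p4:
  fixes d n :: nat and s :: "nat \<Rightarrow> nat" and x y :: Rxy
  assumes "d \<ge> 1"
    and "\<forall>i\<in>{1..d}. s i > 0"
    and "n \<ge> 1"
    and "x = pvar X" and "y = pvar Y"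
  shows "M d s tvar n x y =
    (\<Sum>m\<in>desc_seqs (l s d) n.
      pconst (pconst (1 / (\<Prod>i=1..l s d. of_nat (m i)))) *
      (x + y) ^ (n - m 1) *
      y ^ (m 1 + (\<Sum>r=1..<d. m (l s r + 1)) - (\<Sum>r=1..d. m (l s r))) *
      (\<Prod>r=1..<d. (pconst (tvar r) * x + y) ^ (m (l s r) - m (l s r + 1))) *
      ((pconst (tvar d) * x + y) ^ m (l s d) - y ^ m (l s d)))"
proof -
  define \<iota> where "\<iota> j = (pconst (pconst (1 / of_nat j)) :: Rxy)" for j
  \<comment> \<open>The ratio \<open>1\<close> at index \<open>0\<close> makes
    \<open>z 0 = x + y\<close>, the source of the power of \<open>x + y\<close> in the
    claim.\<close>
  define u where "u r = (if r = 0 then 1 else (pconst (tvar r) :: Rxy))" for r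
  define z where "z r = u r * x + y" for r
  have s: "s (Suc i) > 0" if "i < d" for i using assms(2) that by auto
  have l: "l s r < l s (Suc r)" if "r < d" for r using s[OF that] by (simp add: l_def)
  have inverse: "of_nat (Suc k) * \<iota> (Suc k) = 1" for k
  proof -
    have "of_nat (Suc k) * \<iota> (Suc k) = pconst (pconst (of_nat (Suc k) * (1 / of_nat (Suc k))))"
      by (simp only: \<iota>_def pconst_mult pconst_of_nat)
    also have "of_nat (Suc k) * (1 / of_nat (Suc k)) = (1 :: complex)"
      by (simp del: of_nat_Suc)
    finally show ?thesis by simp
  qed
  obtain v where v: "\<And>r. l s r < l s (Suc r) \<Longrightarrow> v (l s r) = z r"
    "\<And>r i. l s r < i \<Longrightarrow> i < l s (Suc r) \<Longrightarrow> v i = y"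
    using ex_gap_weights[of s z y] by blast
  \<comment> \<open>Positivity ensures that the last entry \<open>m (l s d)\<close> is not the one
    overwritten by \<open>n\<close>.\<close>
  have pos: "l s d > 0" using l[of 0] l_mono[of 1 d s] assms(1) by simp
  have "M d s tvar n x y =
      binom_transform x y (nest u (\<lambda>i j. \<iota> j ^ s (Suc i)) d (\<lambda>j. pconst (tvar d) ^ j)) n"
    unfolding M_def binom_transform_def pconst_lstar[OF assms(1)] u_def \<iota>_def ..
  also have "\<dots> = nest v (\<lambda>_. \<iota>) (l s d) (binom_transform x y (\<lambda>j. pconst (tvar d) ^ j)) n"
    using v l s by (subst binom_transform_nest[OF inverse, where v = v]) (auto simp: z_def)
  also have "\<dots> = (\<Sum>m\<in>desc_seqs (l s d) n.
      (\<Prod>i<l s d. v i ^ ((m(0 := n)) i - m (Suc i)) * \<iota> (m (Suc i))) *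
      ((pconst (tvar d) * x + y) ^ m (l s d) - y ^ m (l s d)))"
    unfolding nest_eq_sum binom_transform_power using pos by simp
  also have "\<dots> = (\<Sum>m\<in>desc_seqs (l s d) n.
      pconst (pconst (1 / (\<Prod>i=1..l s d. of_nat (m i)))) *
      (x + y) ^ (n - m 1) *
      y ^ (m 1 + (\<Sum>r=1..<d. m (l s r + 1)) - (\<Sum>r=1..d. m (l s r))) *
      (\<Prod>r=1..<d. (pconst (tvar r) * x + y) ^ (m (l s r) - m (l s r + 1))) *
      ((pconst (tvar d) * x + y) ^ m (l s d) - y ^ m (l s d)))"
  proof (intro sum.cong refl)
    fix m assume m: "m \<in> desc_seqs (l s d) n"
    have "(\<Prod>i<l s d. \<iota> (m (Suc i))) = (\<Prod>i=1..l s d. \<iota> (m i))"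
      by (rule prod.reindex_bij_witness[where i = "\<lambda>k. k - 1" and j = Suc]) auto
    also have "\<dots> = pconst (pconst (\<Prod>i=1..l s d. 1 / of_nat (m i)))"
      by (simp only: \<iota>_def pconst_prod)
    finally have \<iota>: "(\<Prod>i<l s d. \<iota> (m (Suc i))) = pconst (pconst (1 / (\<Prod>i=1..l s d. of_nat (m i))))"
      by (simp add: prod_dividef)
    have "(m(0 := n)) (l s r) = m (l s r)" if "r \<in> {1..<d}" for r
      using that l[of 0] l_mono[of 1 r s] assms(1) by auto
    then have "(\<Prod>r=1..<d. z r ^ ((m(0 := n)) (l s r) - m (l s r + 1))) =
        (\<Prod>r=1..<d. (pconst (tvar r) * x + y) ^ (m (l s r) - m (l s r + 1)))"
      by (intro prod.cong refl) (simp add: z_def u_def)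
    moreover have "l s 0 = 0" by (simp add: l_def)
    \<comment> \<open>The factor \<open>r = 0\<close> is split off; there the zeroth term is
      \<open>n\<close>, giving the exponent \<open>n - m 1\<close>.\<close>
    ultimately have z: "(\<Prod>r<d. z r ^ ((m(0 := n)) (l s r) - m (l s r + 1))) =
        (x + y) ^ (n - m 1) *
        (\<Prod>r=1..<d. (pconst (tvar r) * x + y) ^ (m (l s r) - m (l s r + 1)))"
      using assms(1)
      by (simp add: lessThan_atLeast0 prod.atLeast_Suc_lessThan z_def u_def)
    have "(\<Prod>i<l s d. v i ^ ((m(0 := n)) i - m (Suc i))) =
        y ^ (\<Sum>r<d. m (l s r + 1) - m (l s (Suc r))) *
        (\<Prod>r<d. z r ^ ((m(0 := n)) (l s r) - m (l s r + 1)))"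
      using s l v by (intro prod_blocks[OF m]) auto
    moreover have "(\<Sum>r<d. m (l s r + 1) - m (l s (Suc r))) =
        m 1 + (\<Sum>r=1..<d. m (l s r + 1)) - (\<Sum>r=1..d. m (l s r))"
      by (rule exponent_of_y[OF m assms(1) s])
    ultimately show "(\<Prod>i<l s d. v i ^ ((m(0 := n)) i - m (Suc i)) * \<iota> (m (Suc i))) *
        ((pconst (tvar d) * x + y) ^ m (l s d) - y ^ m (l s d)) =
      pconst (pconst (1 / (\<Prod>i=1..l s d. of_nat (m i)))) *
      (x + y) ^ (n - m 1) *
      y ^ (m 1 + (\<Sum>r=1..<d. m (l s r + 1)) - (\<Sum>r=1..d. m (l s r))) *
      (\<Prod>r=1..<d. (pconst (tvar r) * x + y) ^ (m (l s r) - m (l s r + 1))) *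
      ((pconst (tvar d) * x + y) ^ m (l s d) - y ^ m (l s d))"
      unfolding prod.distrib \<iota> z by (simp only: mult_ac)
  qed
  finally show ?thesis .
qed

end
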